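(* Let $(V,E,T)$ be an arborescence with thresholds, with leaf set $L$, and let $M_\tau$ be the transition matrix of the Landslide sandpile Markov chain on $\Omega$, driven by the source operators $\sigma_\ell$ ($\ell\in L$) with probabilities $y_\ell$ and the topple operators $\tau_v$ ($v\in V$) with probabilities $x_v$. For $S\subseteq V$ let $$y_S=\sum_{\ell\in L,\ \ell^\downarrow\subseteq S}y_\ell,\qquad x_S=\sum_{v\in S}x_v,\qquad T_S=\prod_{v\in S}T_v,\qquad S^c=V\setminus S$$ (with $T_\emptyset=1$). Then the characteristic polynomial of $M_\tau$ is $$\det(\lambda I-M_\tau)=\prod_{S\subseteq V}(\lambda-y_S-x_S)^{T_{S^c}}.$$
   Context: An arborescence is a finite directed tree with vertex set $V$, edge set $E$ and a special vertex $r\in V$ (the root) such that there is exactly one directed path from any vertex to $r$. For $v\in V$, $v^\downarrow=(v=v_0\to v_1\to\cdots\to v_a=r)$ denotes this path, and also its set of vertices. $V$ is partially ordered by $v\le w$ iff $v\in w^\downarrow$; the leaves are the maximal vertices (those with no incoming edge), and $L$ is the set of leaves. Each vertex $v$ has a threshold $T_v$, a positive integer. The state space is $\Omega=\{(t_v)_{v\in V} : t_v\in\mathbb{Z},\ 0\le t_v\le T_v\}$. Source operator $\sigma_\ell:\Omega\to\Omega$ for $\ell\in L$: with $\ell^\downarrow=(v_0\to\cdots\to v_a)$, let $k\ge0$ be smallest with $t_{v_k}<T_{v_k}$; then $\sigma_\ell(t)$ is $t$ with $t_{v_k}$ increased by $1$. If no such $k$ exists, $\sigma_\ell(t)=t$.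 Operator $\theta_v:\Omega\to\Omega$ for $v\in V$: if $t_v=0$, then $\theta_v(t)=t$. If $t_v>0$, write $v^\downarrow=(v=v_0\to\cdots\to v_a=r)$ and let $k\ge1$ be smallest with $t_{v_k}<T_{v_k}$; then $\theta_v(t)$ is $t$ with $t_v$ decreased by $1$ and $t_{v_k}$ increased by $1$; if no such $k$ exists, $\theta_v(t)$ is $t$ with $t_v$ decreased by $1$. The Landslide topple operator is $\tau_v=\theta_v^{T_v}$ (it empties vertex $v$). Probabilities: real numbers $0<x_v,y_\ell\le1$ ($v\in V$, $\ell\in L$) with $\sum_{v\in V}x_v+\sum_{\ell\in L}y_\ell=1$. The Landslide sandpile Markov chain: at each step, from state $t$, move to $\tau_v(t)$ with probability $x_v$ and to $\sigma_\ell(t)$ with probability $y_\ell$ (probabilities leading to the same state are added). Its transition matrix is the $\Omega\times\Omega$ matrix whose $(t',t)$ entry is the probability of going from $t$ to $t'$. *)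

theory Defs
  imports
    "Graph_Theory.Arc_Walk"
    "Jordan_Normal_Form.Char_Poly"
    "HOL-Library.FuncSet"
begin

text \<open>
  Uniqueness is required among all directed walks to the root, not only among walks without
  repeated vertices.  This is what makes the digraph a tree: the digraph with the two arcs
  from \<open>r\<close> to \<open>v\<close> and from \<open>v\<close> to \<open>r\<close> has unique vertex-simple paths to \<open>r\<close>, but it is
  excluded here.
\<close>

locale arborescence = digraph G for G :: "('a, 'b) pre_digraph" (structure) +
  fixes r :: 'a
  assumes root_in_verts: "r \<in> verts G"
    and unique_walk_to_root: "v \<in> verts G \<Longrightarrow> \<exists>!p. awalk v p r"

definition down_path :: "('a, 'b) pre_digraph \<Rightarrow> 'a \<Rightarrow> 'a \<Rightarrow> 'a list" where
  "down_path G r v =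
     pre_digraph.awalk_verts G v (THE p. pre_digraph.awalk G v p r)"

definition leaves :: "('a, 'b) pre_digraph \<Rightarrow> 'a set" where
  "leaves G = {v \<in> verts G. in_arcs G v = {}}"

definition states :: "('a, 'b) pre_digraph \<Rightarrow> ('a \<Rightarrow> nat) \<Rightarrow> ('a \<Rightarrow> nat) set" where
  "states G T = (\<Pi>\<^sub>E v\<in>verts G. {0..T v})"

definition source ::
  "('a, 'b) pre_digraph \<Rightarrow> 'a \<Rightarrow> ('a \<Rightarrow> nat) \<Rightarrow> 'a \<Rightarrow> ('a \<Rightarrow> nat) \<Rightarrow> ('a \<Rightarrow> nat)" where
  "source G r T l t =
     (case find (\<lambda>w. t w < T w) (down_path G r l) of
        None \<Rightarrow> t
      | Some w \<Rightarrow> t(w := t w + 1))"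

definition trickle ::
  "('a, 'b) pre_digraph \<Rightarrow> 'a \<Rightarrow> ('a \<Rightarrow> nat) \<Rightarrow> 'a \<Rightarrow> ('a \<Rightarrow> nat) \<Rightarrow> ('a \<Rightarrow> nat)"
  \<comment> \<open>the operator \<open>\<theta>\<^sub>v\<close>; the tail of the path encodes the restriction to \<open>k \<ge> 1\<close>\<close>
where
  "trickle G r T v t =
     (if t v = 0 then t
      else case find (\<lambda>w. t w < T w) (tl (down_path G r v)) of
             None \<Rightarrow> t(v := t v - 1)
           | Some w \<Rightarrow> t(v := t v - 1, w := t w + 1))"

definition landslide_topple ::
  "('a, 'b) pre_digraph \<Rightarrow> 'a \<Rightarrow> ('a \<Rightarrow> nat) \<Rightarrow> 'a \<Rightarrow> ('a \<Rightarrow> nat) \<Rightarrow> ('a \<Rightarrow> nat)" where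
  "landslide_topple G r T v = trickle G r T v ^^ T v"

definition landslide_prob ::
  "('a, 'b) pre_digraph \<Rightarrow> 'a \<Rightarrow> ('a \<Rightarrow> nat) \<Rightarrow> ('a \<Rightarrow> real) \<Rightarrow> ('a \<Rightarrow> real) \<Rightarrow>
    ('a \<Rightarrow> nat) \<Rightarrow> ('a \<Rightarrow> nat) \<Rightarrow> real"
  \<comment> \<open>the first state argument is the target, the second one the current state\<close>
where
  "landslide_prob G r T x y t' t =
     (\<Sum>v \<in> {v \<in> verts G. landslide_topple G r T v t = t'}. x v) +
     (\<Sum>l \<in> {l \<in> leaves G. source G r T l t = t'}. y l)"

text \<open>
  The library's matrices are indexed by numbers, so an \<open>\<Omega> \<times> \<Omega>\<close> matrix is presented with
  respect to a list \<open>ts\<close> that enumerates \<open>\<Omega>\<close> without repetition.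
\<close>

definition landslide_matrix ::
  "('a, 'b) pre_digraph \<Rightarrow> 'a \<Rightarrow> ('a \<Rightarrow> nat) \<Rightarrow> ('a \<Rightarrow> real) \<Rightarrow> ('a \<Rightarrow> real) \<Rightarrow>
    ('a \<Rightarrow> nat) list \<Rightarrow> real mat" where
  "landslide_matrix G r T x y ts =
     mat (length ts) (length ts) (\<lambda>(i, j). landslide_prob G r T x y (ts ! i) (ts ! j))"

definition leaf_weight :: "('a, 'b) pre_digraph \<Rightarrow> 'a \<Rightarrow> ('a \<Rightarrow> real) \<Rightarrow> 'a set \<Rightarrow> real" where
  "leaf_weight G r y S = (\<Sum>l \<in> {l \<in> leaves G. set (down_path G r l) \<subseteq> S}. y l)"

end

theory Submission
  imports Defs "Jordan_Normal_Form.Schur_Decomposition"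
begin

text \<open>
  Over a field of characteristic 0 the characteristic polynomial is determined by the traces of
  the powers of the matrix.  The trace of \<open>M\<^sub>\<tau>\<^sup>k\<close> is the sum over all words \<open>w\<close> of
  length \<open>k\<close> in the operators, weighted by their probabilities, of the number of fixed points of
  the composition of \<open>w\<close>.  Let \<open>C\<close> be the set of vertices that are toppled in \<open>w\<close> or lie on
  \<open>\<ell>\<^sup>\<down>\<close> for some source \<open>\<sigma>\<^sub>\<ell>\<close> in \<open>w\<close>.  Grains only move towards the root, so a
  fixed point can be built vertex by vertex from the leaves to the root.  Once everything strictly
  above \<open>v\<close> is fixed, conservation of grains shows that \<open>w\<close> offers to \<open>v\<close> exactly as many grains
  as there are sources of \<open>w\<close> above or at \<open>v\<close>.  Hence \<open>t\<^sub>v\<close> is forced if \<open>v \<in> C\<close> (it forgets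
  its initial value if \<open>v\<close> is toppled, and it must be full otherwise) and arbitrary if \<open>v \<notin> C\<close>.
  So \<open>w\<close> has \<open>\<Prod>\<^bsub>v \<notin> C\<^esub> (T\<^sub>v + 1) = \<Sum>\<^bsub>S \<supseteq> C\<^esub> T\<^bsub>S\<^sup>c\<^esub>\<close> fixed
  points, and summing over all words gives \<open>\<Sum>\<^sub>S T\<^bsub>S\<^sup>c\<^esub> (y\<^sub>S + x\<^sub>S)\<^sup>k\<close>.
\<close>

section \<open>Characteristic polynomials and traces of powers\<close>

lemma sum_mset_poly:
  fixes A :: "'a::comm_ring_1 multiset"
  shows "(\<Sum>a\<in>#A. poly p a) = (\<Sum>i\<le>degree p. coeff p i * (\<Sum>a\<in>#A. a ^ i))"
  by (induction A) (simp_all add: poly_altdef algebra_simps sum.distrib)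

text \<open>A polynomial vanishing at every element other than \<open>c\<close> reads off the
  multiplicity of \<open>c\<close>, up to the nonzero factor \<open>poly p c\<close>. Characteristic
  0 turns equal images of multiplicities in the field into equal multiplicities.\<close>

lemma mset_eq_if_power_sums_eq:
  fixes A B :: "'a::field_char_0 multiset"
  assumes power_sums: "\<And>k. (\<Sum>a\<in>#A. a ^ k) = (\<Sum>b\<in>#B. b ^ k)"
  shows "A = B"
proof (rule multiset_eqI)
  fix c
  \<comment> \<open>By linearity the power sums determine the sum of every polynomial over the multiset.\<close>
  define p where "p = (\<Prod>d\<in>set_mset (A + B) - {c}. [:- d, 1:])"
  have poly_p: "poly p a = (\<Prod>d\<in>set_mset (A + B) - {c}. a - d)" for a
    by (simp add: p_def poly_prod)
  have isolate: "(\<Sum>a\<in>#C. poly p a) = of_nat (count C c) * poly p c" if "C \<subseteq># A + B" for C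
    using that
  proof (induction C)
    case (add a C)
    have "a \<in># A + B"
      using add.prems by (rule mset_subset_eqD) simp
    then have "poly p a = 0" if "a \<noteq> c"
      using that by (auto simp: poly_p)
    moreover have "C \<subseteq># A + B"
      using add.prems by (meson mset_subset_eq_insertD subset_mset.less_imp_le)
    ultimately show ?case
      using add.IH by (auto simp: algebra_simps)
  qed simp
  have "of_nat (count A c) * poly p c = of_nat (count B c) * poly p c"
    using isolate[of A] isolate[of B] by (simp add: sum_mset_poly power_sums)
  moreover have "poly p c \<noteq> 0"
    by (simp add: poly_p)
  ultimately show "count A c = count B c"
    by simp
qed

section \<open>Traces of matrix powers\<close>

definition trace :: "'a::comm_ring_1 mat \<Rightarrow> 'a" where
  "trace A = (\<Sum>i<dim_row A. A $$ (i, i))"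

lemma trace_mult_commute:
  assumes "A \<in> carrier_mat n m" "B \<in> carrier_mat m n"
  shows "trace (A * B) = trace (B * A)"
proof -
  have "trace (A * B) = (\<Sum>i<n. \<Sum>j<m. A $$ (i, j) * B $$ (j, i))"
    using assms by (auto simp: trace_def scalar_prod_def atLeast0LessThan intro!: sum.cong)
  also have "\<dots> = (\<Sum>j<m. \<Sum>i<n. B $$ (j, i) * A $$ (i, j))"
    by (subst sum.swap) (simp add: mult.commute)
  also have "\<dots> = trace (B * A)"
    using assms by (auto simp: trace_def scalar_prod_def atLeast0LessThan intro!: sum.cong)
  finally show ?thesis .
qed

lemma trace_similar:
  assumes "similar_mat_wit A B P Q"
  shows "trace A = trace B"
proof -
  define n where "n = dim_row A"
  note wit = similar_mat_witD[OF n_def assms]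
  have "trace A = trace (P * (B * Q))"
    using wit by (simp add: assoc_mult_mat[of P n n B n Q n])
  also have "\<dots> = trace ((B * Q) * P)"
    using wit by (intro trace_mult_commute[of _ n n]) auto
  also have "(B * Q) * P = B"
    using wit by (simp add: assoc_mult_mat[of B n n Q n P n])
  finally show ?thesis .
qed

text \<open>Only inner indices between \<open>i\<close> and \<open>j\<close> contribute to entry
  \<open>(i, j)\<close>, so the sum is empty below the diagonal and has a single term on it.\<close>

lemma upper_triangular_mult:
  fixes A B :: "'a::comm_ring_1 mat"
  assumes A: "A \<in> carrier_mat n n" and B: "B \<in> carrier_mat n n"
    and ut: "upper_triangular A" "upper_triangular B"
  shows "upper_triangular (A * B)"
    and "i < n \<Longrightarrow> (A * B) $$ (i, i) = A $$ (i, i) * B $$ (i, i)"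
proof -
  have entry: "(A * B) $$ (i, j) = (\<Sum>k\<in>{i..j}. A $$ (i, k) * B $$ (k, j))"
    if "i < n" "j < n" for i j
  proof -
    have "(A * B) $$ (i, j) = (\<Sum>k<n. A $$ (i, k) * B $$ (k, j))"
      using A B that by (auto simp: scalar_prod_def atLeast0LessThan intro!: sum.cong)
    also have "\<dots> = (\<Sum>k\<in>{i..j}. A $$ (i, k) * B $$ (k, j))"
    proof (rule sum.mono_neutral_right)
      show "\<forall>k\<in>{..<n} - {i..j}. A $$ (i, k) * B $$ (k, j) = 0"
      proof
        fix k assume k: "k \<in> {..<n} - {i..j}"
        then have "k < i \<or> j < k" by auto
        then show "A $$ (i, k) * B $$ (k, j) = 0"
          using k that ut A B by (auto simp: upper_triangularD)
      qed
    qed (use that in auto)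
    finally show ?thesis .
  qed
  show "upper_triangular (A * B)"
    using A B by (intro upper_triangularI) (simp add: entry del: index_mult_mat(1))
  show "(A * B) $$ (i, i) = A $$ (i, i) * B $$ (i, i)" if "i < n"
    using that by (simp add: entry)
qed

lemma upper_triangular_pow:
  fixes A :: "'a::comm_ring_1 mat"
  assumes A: "A \<in> carrier_mat n n" and ut: "upper_triangular A"
  shows "upper_triangular (A ^\<^sub>m k) \<and> (\<forall>i<n. (A ^\<^sub>m k) $$ (i, i) = (A $$ (i, i)) ^ k)"
proof (induction k)
  case 0
  then show ?case using A by simp
next
  case (Suc k)
  then show ?case
    using upper_triangular_mult[of "A ^\<^sub>m k" n A] A ut by (simp add: mult.commute)
qed

text \<open>Schur decomposition yields a similar upper triangular matrix with diagonal
  \<open>as\<close>. The trace is invariant under similarity, and powers of a triangular matrix act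
  entrywise on its diagonal.\<close>

lemma trace_pow_eq_power_sum:
  fixes A :: "complex mat"
  assumes A: "A \<in> carrier_mat n n" and factors: "char_poly A = (\<Prod>a\<leftarrow>as. [:- a, 1:])"
  shows "trace (A ^\<^sub>m k) = (\<Sum>a\<in>#mset as. a ^ k)"
proof -
  obtain B P Q where "schur_decomposition A as = (B, P, Q)"
    by (cases "schur_decomposition A as")
  then have wit: "similar_mat_wit A B P Q" and ut: "upper_triangular B" and diag: "diag_mat B = as"
    using schur_decomposition[OF A factors] by auto
  have B: "B \<in> carrier_mat n n"
    using similar_mat_witD2[OF A wit] by simp
  have "trace (A ^\<^sub>m k) = (\<Sum>i<n. (B $$ (i, i)) ^ k)"
    using trace_similar[OF similar_mat_wit_pow[OF wit, of k]] upper_triangular_pow[OF B ut, of k] B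
    by (auto simp: trace_def)
  also have "\<dots> = (\<Sum>a\<leftarrow>diag_mat B. a ^ k)"
    using B by (simp add: diag_mat_def sum_list_sum_nth atLeast0LessThan)
  finally show ?thesis
    unfolding diag by (metis mset_map sum_mset_sum_list)
qed

lemma char_poly_eq_if_traces_eq:
  fixes A :: "complex mat"
  assumes A: "A \<in> carrier_mat n n"
    and traces: "\<And>k. trace (A ^\<^sub>m k) = (\<Sum>b\<in>#B. b ^ k)"
  shows "char_poly A = (\<Prod>b\<in>#B. [:- b, 1:])"
proof -
  obtain as where as: "char_poly A = (\<Prod>a\<leftarrow>as. [:- a, 1:])"
    using char_poly_factorized[OF A] by blast
  then have "mset as = B"
    using trace_pow_eq_power_sum[OF A as] traces by (intro mset_eq_if_power_sums_eq) simp
  then show ?thesis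
    using as by (metis mset_map prod_mset_prod_list)
qed

text \<open>Splitting into linear factors is available over the complex numbers, so the matrix is
  mapped there and the identity is pulled back along the injective embedding. Different
  \<open>i\<close> may share a value \<open>e i\<close>; the multiset \<open>B\<close> adds up their
  multiplicities.\<close>

lemma char_poly_real_eq_if_traces_eq:
  fixes A :: "real mat"
  assumes A: "A \<in> carrier_mat n n" and fin: "finite I"
    and traces: "\<And>k. trace (A ^\<^sub>m k) = (\<Sum>i\<in>I. of_nat (m i) * e i ^ k)"
  shows "char_poly A = (\<Prod>i\<in>I. [:- e i, 1:] ^ m i)"
proof -
  let ?c = "complex_of_real"
  interpret cmap: map_poly_inj_comm_ring_hom ?c ..
  define B where "B = (\<Sum>i\<in>I. replicate_mset (m i) (?c (e i)))"
  have "trace ((map_mat ?c A) ^\<^sub>m k) = (\<Sum>b\<in>#B. b ^ k)" for k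
  proof -
    have "trace ((map_mat ?c A) ^\<^sub>m k) = ?c (trace (A ^\<^sub>m k))"
      using A by (simp add: trace_def flip: of_real_hom.mat_hom_pow[OF A])
    also have "\<dots> = (\<Sum>b\<in>#B. b ^ k)"
      unfolding traces B_def using fin by (induction I rule: finite_induct) auto
    finally show ?thesis .
  qed
  then have "char_poly (map_mat ?c A) = (\<Prod>b\<in>#B. [:- b, 1:])"
    using A by (intro char_poly_eq_if_traces_eq) auto
  also have "\<dots> = (\<Prod>i\<in>I. [:- ?c (e i), 1:] ^ m i)"
    unfolding B_def using fin by (induction I rule: finite_induct) auto
  also have "\<dots> = map_poly ?c (\<Prod>i\<in>I. [:- e i, 1:] ^ m i)"
    by (simp add: cmap.hom_prod cmap.hom_power)
  finally show ?thesis
    using A by (simp add: of_real_hom.char_poly_hom)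
qed

section \<open>Random actions on a finite set\<close>

lemma sum_lists_length_prod_list:
  fixes p :: "'g \<Rightarrow> 'c::comm_semiring_1"
  assumes "finite A"
  shows "(\<Sum>w\<in>{w. set w \<subseteq> A \<and> length w = k}. prod_list (map p w)) = (\<Sum>g\<in>A. p g) ^ k"
proof (induction k)
  case 0
  have "{w. set w \<subseteq> A \<and> length w = 0} = {[]}" by auto
  then show ?case by simp
next
  case (Suc k)
  let ?W = "{w. set w \<subseteq> A \<and> length w = k}"
  have "(\<Sum>w\<in>{w. set w \<subseteq> A \<and> length w = Suc k}. prod_list (map p w))
      = (\<Sum>(g, w)\<in>A \<times> ?W. p g * prod_list (map p w))"
    by (rule sum.reindex_bij_witness[of _ "\<lambda>(g, w). g # w" "\<lambda>w. (hd w, tl w)"])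
      (auto simp: length_Suc_conv)
  also have "\<dots> = (\<Sum>g\<in>A. p g) * (\<Sum>w\<in>?W. prod_list (map p w))"
    by (simp add: sum_product sum.cartesian_product)
  finally show ?case using Suc.IH by simp
qed

definition action_matrix ::
  "'g set \<Rightarrow> ('g \<Rightarrow> 's \<Rightarrow> 's) \<Rightarrow> ('g \<Rightarrow> 'c::comm_ring_1) \<Rightarrow> 's list \<Rightarrow> 'c mat" where
  "action_matrix A act p ts = mat (length ts) (length ts)
     (\<lambda>(i, j). \<Sum>g\<in>{g \<in> A. act g (ts ! j) = ts ! i}. p g)"

text \<open>Each operator acts deterministically, so a path of length \<open>k\<close> from a given
  state amounts to a word of operators. \<open>fold\<close> applies the head first, which matches
  the right factor when one more power is split off.\<close>

lemma action_matrix_pow: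
  assumes fin: "finite A" and dist: "distinct ts"
    and closed: "\<And>g t. g \<in> A \<Longrightarrow> t \<in> set ts \<Longrightarrow> act g t \<in> set ts"
    and "i < length ts" "j < length ts"
  shows "(action_matrix A act p ts ^\<^sub>m k) $$ (i, j) =
    (\<Sum>w\<in>{w. set w \<subseteq> A \<and> length w = k}.
       if fold act w (ts ! j) = ts ! i then prod_list (map p w) else 0)"
  using assms(4,5)
proof (induction k arbitrary: i j)
  case 0
  have "{w. set w \<subseteq> A \<and> length w = 0} = {[]}" by auto
  then show ?case
    using 0 dist by (auto simp: action_matrix_def nth_eq_iff_index_eq)
next
  case (Suc k)
  let ?M = "action_matrix A act p ts" and ?n = "length ts"
  let ?W = "{w. set w \<subseteq> A \<and> length w = k}"
  have M: "?M \<in> carrier_mat ?n ?n" by (simp add: action_matrix_def)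
  have Mk: "?M ^\<^sub>m k \<in> carrier_mat ?n ?n" using M by (rule pow_carrier_mat)
  have "(?M ^\<^sub>m Suc k) $$ (i, j) = (\<Sum>l<?n. (?M ^\<^sub>m k) $$ (i, l) * ?M $$ (l, j))"
    using M Mk Suc.prems by (auto simp: scalar_prod_def atLeast0LessThan intro!: sum.cong)
  also have "\<dots> = (\<Sum>l<?n. (?M ^\<^sub>m k) $$ (i, l) *
      (\<Sum>g\<in>A. if act g (ts ! j) = ts ! l then p g else 0))"
    using Suc.prems fin by (intro sum.cong) (auto simp: action_matrix_def sum.If_cases Int_def)
  also have "\<dots> = (\<Sum>g\<in>A. \<Sum>l<?n. if act g (ts ! j) = ts ! l then (?M ^\<^sub>m k) $$ (i, l) * p g else 0)"
    by (subst sum.swap) (auto simp: sum_distrib_left intro!: sum.cong)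
  also have "\<dots> = (\<Sum>g\<in>A. \<Sum>w\<in>?W.
      if fold act w (act g (ts ! j)) = ts ! i then prod_list (map p w) * p g else 0)"
  proof (rule sum.cong[OF refl])
    fix g assume "g \<in> A"
    then have "act g (ts ! j) \<in> set ts"
      using closed Suc.prems by auto
    \<comment> \<open>Closure supplies an index for the successor state; distinctness of
      \<open>ts\<close> makes it the only summand that survives.\<close>
    then obtain l where l: "l < ?n" "act g (ts ! j) = ts ! l"
      by (metis in_set_conv_nth)
    have "(\<Sum>l'<?n. if act g (ts ! j) = ts ! l' then (?M ^\<^sub>m k) $$ (i, l') * p g else 0)
        = (\<Sum>l'<?n. if l' = l then (?M ^\<^sub>m k) $$ (i, l') * p g else 0)"
      using l dist by (intro sum.cong) (auto simp: nth_eq_iff_index_eq)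
    also have "\<dots> = (?M ^\<^sub>m k) $$ (i, l) * p g"
      using l by simp
    also have "\<dots> = (\<Sum>w\<in>?W. if fold act w (act g (ts ! j)) = ts ! i
        then prod_list (map p w) * p g else 0)"
      using Suc l by (simp add: sum_distrib_right if_distrib if_distribR cong: if_cong)
    finally show "(\<Sum>l'<?n. if act g (ts ! j) = ts ! l' then (?M ^\<^sub>m k) $$ (i, l') * p g else 0)
        = (\<Sum>w\<in>?W. if fold act w (act g (ts ! j)) = ts ! i
        then prod_list (map p w) * p g else 0)" .
  qed
  also have "\<dots> = (\<Sum>(g, w)\<in>A \<times> ?W.
      if fold act w (act g (ts ! j)) = ts ! i then prod_list (map p w) * p g else 0)"
    by (simp add: sum.cartesian_product)
  also have "\<dots> = (\<Sum>w\<in>{w. set w \<subseteq> A \<and> length w = Suc k}.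
      if fold act w (ts ! j) = ts ! i then prod_list (map p w) else 0)"
    by (rule sum.reindex_bij_witness[of _ "\<lambda>w. (hd w, tl w)" "\<lambda>(g, w). g # w"])
      (auto simp: length_Suc_conv mult.commute)
  finally show ?case .
qed

lemma trace_action_matrix_pow:
  assumes fin: "finite A" and dist: "distinct ts"
    and closed: "\<And>g t. g \<in> A \<Longrightarrow> t \<in> set ts \<Longrightarrow> act g t \<in> set ts"
  shows "trace (action_matrix A act p ts ^\<^sub>m k) =
    (\<Sum>w\<in>{w. set w \<subseteq> A \<and> length w = k}.
       of_nat (card {t \<in> set ts. fold act w t = t}) * prod_list (map p w))"
proof -
  let ?W = "{w. set w \<subseteq> A \<and> length w = k}"
  have dim: "dim_row (action_matrix A act p ts ^\<^sub>m k) = length ts"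
    by (simp add: action_matrix_def)
  have "trace (action_matrix A act p ts ^\<^sub>m k) = (\<Sum>i<length ts. \<Sum>w\<in>?W.
       if fold act w (ts ! i) = ts ! i then prod_list (map p w) else 0)"
    unfolding trace_def dim by (intro sum.cong refl action_matrix_pow assms) auto
  also have "\<dots> = (\<Sum>w\<in>?W. \<Sum>i<length ts.
       if fold act w (ts ! i) = ts ! i then prod_list (map p w) else 0)"
    by (rule sum.swap)
  also have "\<dots> = (\<Sum>w\<in>?W. \<Sum>t\<in>set ts. if fold act w t = t then prod_list (map p w) else 0)"
    using dist by (intro sum.cong refl sum.reindex_bij_betw bij_betw_nth) (auto simp: lessThan_atLeast0)
  also have "\<dots> = (\<Sum>w\<in>?W. of_nat (card {t \<in> set ts. fold act w t = t}) * prod_list (map p w))"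
    by (simp add: sum.If_cases Int_def)
  finally show ?thesis .
qed

text \<open>Exchanging the sums over words and over \<open>i\<close> turns the trace of the
  \<open>k\<close>-th power into a power sum with multiplicities \<open>m i\<close>, because the
  words of length \<open>k\<close> over \<open>B i\<close> have total weight
  \<open>(\<Sum>g\<in>B i. p g) ^ k\<close>.\<close>

lemma char_poly_action_matrix:
  fixes p :: "'g \<Rightarrow> real" and m :: "'i \<Rightarrow> nat"
  assumes fin: "finite A" "finite I" and dist: "distinct ts"
    and closed: "\<And>g t. g \<in> A \<Longrightarrow> t \<in> set ts \<Longrightarrow> act g t \<in> set ts"
    and fixed_points: "\<And>w. set w \<subseteq> A \<Longrightarrow>
      card {t \<in> set ts. fold act w t = t} = (\<Sum>i\<in>{i \<in> I. set w \<subseteq> B i}. m i)"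
    and B: "\<And>i. i \<in> I \<Longrightarrow> B i \<subseteq> A"
  shows "char_poly (action_matrix A act p ts) = (\<Prod>i\<in>I. [:- (\<Sum>g\<in>B i. p g), 1:] ^ m i)"
proof (rule char_poly_real_eq_if_traces_eq)
  show "action_matrix A act p ts \<in> carrier_mat (length ts) (length ts)"
    by (simp add: action_matrix_def)
  fix k
  let ?W = "{w. set w \<subseteq> A \<and> length w = k}"
  have fin_W: "finite ?W"
    using fin by (rule_tac finite_lists_length_eq)
  have "trace (action_matrix A act p ts ^\<^sub>m k) =
      (\<Sum>w\<in>?W. \<Sum>i\<in>I. if set w \<subseteq> B i then of_nat (m i) * prod_list (map p w) else 0)"
    using fin by (simp add: trace_action_matrix_pow[OF fin(1) dist closed] fixed_points
      sum.If_cases sum_distrib_right Int_def)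
  also have "\<dots> = (\<Sum>i\<in>I. \<Sum>w\<in>?W. if set w \<subseteq> B i then of_nat (m i) * prod_list (map p w) else 0)"
    by (rule sum.swap)
  also have "\<dots> = (\<Sum>i\<in>I. of_nat (m i) * (\<Sum>g\<in>B i. p g) ^ k)"
  proof (rule sum.cong[OF refl])
    fix i assume i: "i \<in> I"
    have "?W \<inter> {w. set w \<subseteq> B i} = {w. set w \<subseteq> B i \<and> length w = k}"
      using B[OF i] by auto
    then show "(\<Sum>w\<in>?W. if set w \<subseteq> B i then of_nat (m i) * prod_list (map p w) else 0)
        = of_nat (m i) * (\<Sum>g\<in>B i. p g) ^ k"
      using fin_W finite_subset[OF B[OF i] fin(1)]
      by (simp add: sum.If_cases sum_lists_length_prod_list flip: sum_distrib_left)
  qed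
  finally show "trace (action_matrix A act p ts ^\<^sub>m k) =
    (\<Sum>i\<in>I. of_nat (m i) * (\<Sum>g\<in>B i. p g) ^ k)" .
qed (use fin in auto)

section \<open>Dynamics of the Landslide sandpile\<close>

lemma (in arborescence) down_path_eq_awalk_verts:
  assumes "awalk v p r"
  shows "down_path G r v = awalk_verts v p"
proof -
  have "v \<in> verts G" using assms by blast
  then have "(THE p. awalk v p r) = p"
    using unique_walk_to_root assms by (intro the1_equality)
  then show ?thesis by (simp add: down_path_def)
qed

lemma (in arborescence) down_path_eq_Cons:
  assumes "v \<in> verts G"
  shows "down_path G r v = v # tl (down_path G r v)"
proof -
  obtain p where "awalk v p r"
    using unique_walk_to_root assms by blast
  then show ?thesis
    by (metis awalk_verts_non_Nil awends_of_awalk(1) down_path_eq_awalk_verts list.collapse)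
qed

lemma (in arborescence) set_down_path_subset:
  assumes "v \<in> verts G"
  shows "set (down_path G r v) \<subseteq> verts G"
proof -
  obtain p where "awalk v p r"
    using unique_walk_to_root assms by blast
  then show ?thesis
    using down_path_eq_awalk_verts by (metis awalkE')
qed

text \<open>The rest of a walk to the root is again a walk to the root, hence the unique one from
  its start.\<close>

lemma (in arborescence) down_path_suffix:
  assumes "v \<in> verts G" and decomp: "down_path G r v = xs @ w # ys"
  shows "down_path G r w = w # ys"
proof -
  obtain p where p: "awalk v p r"
    using unique_walk_to_root assms by blast
  then have "cas v p r" and verts_p: "awalk_verts v p = xs @ w # ys"
    using decomp by (auto simp: down_path_eq_awalk_verts)
  then obtain q s where s: "cas w s r" "p = q @ s" "awalk_verts w s = w # ys"
    by (rule awalk_decomp_verts)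
  have "w \<in> verts G"
    using set_down_path_subset[OF assms(1)] decomp by auto
  with s p have "awalk w s r"
    by (auto simp: awalk_def)
  with s show ?thesis
    by (simp add: down_path_eq_awalk_verts)
qed

definition strictly_above :: "('a, 'b) pre_digraph \<Rightarrow> 'a \<Rightarrow> 'a \<Rightarrow> 'a set" where
  "strictly_above G r v = {u \<in> verts G. v \<in> set (tl (down_path G r u))}"

context arborescence
begin

lemma strictly_above_subset: "strictly_above G r v \<subseteq> verts G"
  by (auto simp: strictly_above_def)

lemma finite_strictly_above [simp]: "finite (strictly_above G r v)"
  using finite_subset[OF strictly_above_subset] by simp

text \<open>If \<open>v\<close> recurred on its own path, the suffix from the recurrence would by
  uniqueness be the whole path, although it is shorter.\<close>

lemma strictly_above_irrefl [simp]: "v \<notin> strictly_above G r v"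
proof
  assume "v \<in> strictly_above G r v"
  then have v: "v \<in> verts G" "v \<in> set (tl (down_path G r v))"
    by (auto simp: strictly_above_def)
  then obtain xs ys where decomp: "tl (down_path G r v) = xs @ v # ys"
    by (meson split_list)
  then have "down_path G r v = (v # xs) @ v # ys"
    using down_path_eq_Cons[OF v(1)] by simp
  then have "down_path G r v = v # ys"
    using down_path_suffix[OF v(1)] by blast
  with decomp have "length ys = length (xs @ v # ys)"
    by (metis list.sel(3))
  then show False by simp
qed

lemma strictly_above_mono:
  assumes "u \<in> strictly_above G r v"
  shows "strictly_above G r u \<subseteq> strictly_above G r v"
proof
  fix x assume "x \<in> strictly_above G r u"
  then have x: "x \<in> verts G" "u \<in> set (tl (down_path G r x))"
    by (auto simp: strictly_above_def)
  then obtain xs ys where decomp: "tl (down_path G r x) = xs @ u # ys"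
    by (meson split_list)
  then have "down_path G r x = (x # xs) @ u # ys"
    using down_path_eq_Cons[OF x(1)] by simp
  then have "down_path G r u = u # ys"
    using down_path_suffix[OF x(1)] by blast
  then have "v \<in> set ys"
    using assms by (simp add: strictly_above_def)
  then show "x \<in> strictly_above G r v"
    using x decomp by (simp add: strictly_above_def)
qed

text \<open>This measure grows from the leaves towards the root. It carries the induction for single
  steps and later selects a lowest vertex of an upward closed set.\<close>

lemma card_strictly_above_less:
  assumes "u \<in> strictly_above G r v"
  shows "card (strictly_above G r u) < card (strictly_above G r v)"
  by (metis assms finite_strictly_above psubsetI psubset_card_mono strictly_above_irrefl strictly_above_mono)

end

section \<open>Dropping a grain along a path\<close>

text \<open>The common core of \<open>source\<close> and \<open>trickle\<close>. The list is a
  parameter since a source offers its grain to a whole path, a topple only to its tail.\<close>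

definition drop_grain :: "('a \<Rightarrow> nat) \<Rightarrow> 'a list \<Rightarrow> ('a \<Rightarrow> nat) \<Rightarrow> 'a \<Rightarrow> nat" where
  "drop_grain T ps t =
     (case find (\<lambda>w. t w < T w) ps of None \<Rightarrow> t | Some w \<Rightarrow> t(w := t w + 1))"

lemma drop_grain_cases:
  obtains (full) "\<And>w. w \<in> set ps \<Longrightarrow> T w \<le> t w" "drop_grain T ps t = t"
  | (lands) xs w ys where "ps = xs @ w # ys" "\<And>u. u \<in> set xs \<Longrightarrow> T u \<le> t u" "t w < T w"
      "drop_grain T ps t = t(w := t w + 1)"
proof (cases "find (\<lambda>w. t w < T w) ps")
  case None
  then have "drop_grain T ps t = t"
    by (simp add: drop_grain_def)
  then show ?thesis
    using None by (intro full) (auto simp: find_None_iff not_less)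
next
  case (Some w)
  then obtain i where i: "i < length ps" "t w < T w" "w = ps ! i" "\<And>j. j < i \<Longrightarrow> \<not> t (ps ! j) < T (ps ! j)"
    by (auto simp: find_Some_iff)
  show ?thesis
  proof (rule lands)
    show "ps = take i ps @ w # drop (Suc i) ps"
      using i by (simp add: id_take_nth_drop)
    show "T u \<le> t u" if "u \<in> set (take i ps)" for u
      using that i by (auto simp: in_set_conv_nth not_less)
  qed (use Some i in \<open>auto simp: drop_grain_def\<close>)
qed

lemma find_eq_Some_in_set: "find P xs = Some x \<Longrightarrow> x \<in> set xs"
  by (auto simp: find_Some_iff)

text \<open>A vertex off the list is neither read nor written.\<close>

lemma drop_grain_commute_upd:
  assumes "v \<notin> set ps"
  shows "drop_grain T ps (t(v := a)) = (drop_grain T ps t)(v := a)"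
proof -
  have "find (\<lambda>w. (t(v := a)) w < T w) ps = find (\<lambda>w. t w < T w) ps"
    using assms by (intro find_cong) auto
  moreover have "find (\<lambda>w. t w < T w) ps \<noteq> Some v"
    using assms by (auto dest: find_eq_Some_in_set)
  ultimately show ?thesis
    by (auto simp: drop_grain_def fun_upd_twist split: option.splits)
qed

lemma drop_grain_other: "v \<notin> set ps \<Longrightarrow> drop_grain T ps t v = t v"
  by (metis drop_grain_commute_upd fun_upd_same fun_upd_triv)

lemma funpow_drop_grain_other: "v \<notin> set ps \<Longrightarrow> (drop_grain T ps ^^ n) t v = t v"
  by (induction n) (simp_all add: drop_grain_other)

lemma drop_grain_states:
  assumes "t \<in> states G T" "set ps \<subseteq> verts G"
  shows "drop_grain T ps t \<in> states G T"
  using assms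
  by (cases rule: drop_grain_cases[of ps T t])
    (auto simp: states_def PiE_iff extensional_def)

lemma funpow_drop_grain_states:
  assumes "t \<in> states G T" "set ps \<subseteq> verts G"
  shows "(drop_grain T ps ^^ n) t \<in> states G T"
  using assms by (induction n) (simp_all add: drop_grain_states)

lemma states_upd:
  "t \<in> states G T \<Longrightarrow> v \<in> verts G \<Longrightarrow> a \<le> T v \<Longrightarrow> t(v := a) \<in> states G T"
  by (auto simp: states_def PiE_iff extensional_def)

lemma states_le: "t \<in> states G T \<Longrightarrow> v \<in> verts G \<Longrightarrow> t v \<le> T v"
  by (auto simp: states_def PiE_iff)

section \<open>Conservation of grains\<close>

definition load :: "('a, 'b) pre_digraph \<Rightarrow> 'a \<Rightarrow> 'a \<Rightarrow> ('a \<Rightarrow> nat) \<Rightarrow> nat" where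
  "load G r v t = (\<Sum>u\<in>strictly_above G r v. t u)"

text \<open>
  Letting \<open>k\<close> grains enter the part of the tree above or at \<open>v\<close>, conservation of grains says that
  \<open>load G r v t + k - load G r v t'\<close> of them are offered to \<open>v\<close>.  In contrast to the number of
  offered grains this expression telescopes along a sequence of steps.
\<close>

definition flow ::
  "('a, 'b) pre_digraph \<Rightarrow> 'a \<Rightarrow> ('a \<Rightarrow> nat) \<Rightarrow> 'a \<Rightarrow> nat \<Rightarrow> ('a \<Rightarrow> nat) \<Rightarrow> ('a \<Rightarrow> nat) \<Rightarrow> bool" where
  "flow G r T v k t t' \<longleftrightarrow> load G r v t' \<le> load G r v t + k \<and>
     t' v = min (T v) (t v + (load G r v t + k - load G r v t'))"

lemma flow_refl: "t v \<le> T v \<Longrightarrow> flow G r T v 0 t t"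
  by (simp add: flow_def)

text \<open>The loads telescope, and capping at \<open>T v\<close> after each stage agrees with
  capping once at the end.\<close>

lemma flow_trans:
  "flow G r T v k t t' \<Longrightarrow> flow G r T v k' t' t'' \<Longrightarrow> flow G r T v (k + k') t t''"
  unfolding flow_def by linarith

definition landslide_step ::
  "('a, 'b) pre_digraph \<Rightarrow> 'a \<Rightarrow> ('a \<Rightarrow> nat) \<Rightarrow> 'a + 'a \<Rightarrow> ('a \<Rightarrow> nat) \<Rightarrow> 'a \<Rightarrow> nat" where
  "landslide_step G r T g =
     (case g of Inl v \<Rightarrow> landslide_topple G r T v | Inr l \<Rightarrow> source G r T l)"

text \<open>Only grains from outside are counted. A topple brings none, since what leaves a vertex
  above \<open>v\<close> is already part of \<open>load\<close>.\<close>

definition grains :: "('a, 'b) pre_digraph \<Rightarrow> 'a \<Rightarrow> 'a + 'a \<Rightarrow> 'a \<Rightarrow> nat" where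
  "grains G r g v =
     (case g of Inl u \<Rightarrow> 0 | Inr l \<Rightarrow> if v \<in> set (down_path G r l) then 1 else 0)"

definition touched :: "('a, 'b) pre_digraph \<Rightarrow> 'a \<Rightarrow> ('a + 'a) list \<Rightarrow> 'a set" where
  "touched G r w = {v. Inl v \<in> set w} \<union> (\<Union>l\<in>{l. Inr l \<in> set w}. set (down_path G r l))"

lemma touched_iff:
  "v \<in> touched G r w \<longleftrightarrow> Inl v \<in> set w \<or> (\<Sum>g\<leftarrow>w. grains G r g v) \<noteq> 0"
proof -
  have "grains G r g v \<noteq> 0 \<longleftrightarrow> (\<exists>l. g = Inr l \<and> v \<in> set (down_path G r l))" for g
    by (auto simp: grains_def split: sum.splits)
  then show ?thesis
    by (auto simp: touched_def)
qed

context arborescence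
begin

text \<open>The additive form avoids truncated subtraction of natural numbers.\<close>

lemma load_upd:
  "load G r v (t(w := a)) + (if w \<in> strictly_above G r v then t w else 0) =
   load G r v t + (if w \<in> strictly_above G r v then a else 0)"
proof (cases "w \<in> strictly_above G r v")
  case True
  then show ?thesis by (simp add: load_def sum.remove[of "strictly_above G r v" w])
next
  case False
  then show ?thesis by (auto simp: load_def intro!: sum.cong)
qed

text \<open>If the grain settles strictly above \<open>v\<close>, the load absorbs it. Otherwise it
  is offered to \<open>v\<close> exactly if \<open>v\<close> is on \<open>ps\<close>; then it
  settles there, or \<open>v\<close> is full and passes it on, as the cap \<open>T v\<close>
  demands.\<close>

lemma flow_drop_grain:
  assumes u: "u \<in> verts G" and ps: "down_path G r u = zs @ ps" and "t v \<le> T v"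
  shows "flow G r T v (if v \<in> set ps then 1 else 0) t (drop_grain T ps t)"
proof (cases rule: drop_grain_cases[of ps T t])
  case full
  then have "v \<in> set ps \<Longrightarrow> t v = T v"
    using assms(3) by (simp add: le_antisym)
  with full(2) assms(3) show ?thesis by (simp add: flow_def)
next
  case (lands xs w ys)
  have "w \<in> verts G"
    using set_down_path_subset[OF u] ps lands by auto
  moreover have "down_path G r w = w # ys"
    using down_path_suffix[OF u, of "zs @ xs" w ys] ps lands by simp
  ultimately have "w \<in> strictly_above G r v \<longleftrightarrow> v \<in> set ys"
    by (simp add: strictly_above_def)
  note load = load_upd[of v t w "t w + 1", folded lands(4), unfolded this]
  show ?thesis
  proof (cases "v \<in> set ys")
    case True
    then have "v \<noteq> w"
      using \<open>w \<in> strictly_above G r v \<longleftrightarrow> v \<in> set ys\<close> by auto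
    then show ?thesis
      using True load lands assms(3) by (simp add: flow_def)
  next
    case False
    moreover have "v \<in> set xs \<Longrightarrow> t v = T v"
      using lands(2) assms(3) by (simp add: le_antisym)
    ultimately show ?thesis
      using load lands assms(3) by (auto simp: flow_def)
  qed
qed

lemma flow_funpow_drop_grain:
  assumes u: "u \<in> verts G" and v: "v \<in> verts G"
    and ps: "down_path G r u = zs @ ps" and t: "t \<in> states G T"
  shows "flow G r T v (if v \<in> set ps then n else 0) t ((drop_grain T ps ^^ n) t)"
proof (induction n)
  case 0
  then show ?case using states_le[OF t v] by (simp add: flow_refl)
next
  case (Suc n)
  have "set ps \<subseteq> verts G" using set_down_path_subset[OF u] ps by auto
  then have "(drop_grain T ps ^^ n) t \<in> states G T"
    using t by (intro funpow_drop_grain_states)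
  then have "flow G r T v (if v \<in> set ps then 1 else 0)
      ((drop_grain T ps ^^ n) t) ((drop_grain T ps ^^ Suc n) t)"
    using v by (simp add: flow_drop_grain[OF u ps] states_le del: One_nat_def)
  from flow_trans[OF Suc this] show ?case
    by (simp split: if_splits)
qed

section \<open>Topples as repeated drops\<close>

lemma notin_tl_down_path: "v \<in> verts G \<Longrightarrow> v \<notin> set (tl (down_path G r v))"
  using strictly_above_irrefl by (simp add: strictly_above_def)

lemma trickle_eq:
  assumes "v \<in> verts G" "t v > 0"
  shows "trickle G r T v t = drop_grain T (tl (down_path G r v)) (t(v := t v - 1))"
proof -
  have "find (\<lambda>w. t w < T w) (tl (down_path G r v)) \<noteq> Some v"
    using notin_tl_down_path[OF assms(1)] by (auto dest: find_eq_Some_in_set)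
  then have "trickle G r T v t = (drop_grain T (tl (down_path G r v)) t)(v := t v - 1)"
    using assms(2) by (auto simp: trickle_def drop_grain_def fun_upd_twist split: option.split)
  then show ?thesis
    by (simp add: drop_grain_commute_upd notin_tl_down_path assms(1))
qed

text \<open>Since \<open>v\<close> is not on the tail of its own path, removing grains from
  \<open>v\<close> commutes with dropping them below, and all removals can be done first.\<close>

lemma funpow_trickle:
  assumes "v \<in> verts G"
  shows "(trickle G r T v ^^ t v) t = (drop_grain T (tl (down_path G r v)) ^^ t v) (t(v := 0))"
proof (induction "t v" arbitrary: t)
  case 0
  then have "t v = 0" by simp
  then show ?case by (simp add: fun_upd_idem)
next
  case (Suc n)
  let ?drop = "drop_grain T (tl (down_path G r v))"
  note drop_upd = drop_grain_commute_upd[OF notin_tl_down_path[OF assms]]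
  have step: "trickle G r T v t = ?drop (t(v := n))"
    using trickle_eq[OF assms, of t T] by (simp flip: Suc.hyps(2))
  then have grains_left: "trickle G r T v t v = n"
    by (simp add: drop_upd)
  have "(trickle G r T v ^^ n) (trickle G r T v t) = (?drop ^^ n) ((trickle G r T v t)(v := 0))"
    using Suc.hyps(1)[of "trickle G r T v t"] unfolding grains_left by simp
  also have "(trickle G r T v t)(v := 0) = ?drop (t(v := 0))"
    unfolding step drop_upd by simp
  finally show ?case
    unfolding Suc.hyps(2)[symmetric] funpow_Suc_right o_apply .
qed

text \<open>After \<open>t v\<close> rounds the vertex is empty, and the remaining
  \<open>T v - t v\<close> rounds of \<open>trickle\<close> change nothing.\<close>

lemma landslide_topple_eq:
  assumes "v \<in> verts G" "t v \<le> T v"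
  shows "landslide_topple G r T v t =
    (drop_grain T (tl (down_path G r v)) ^^ t v) (t(v := 0))"
proof -
  let ?s = "(trickle G r T v ^^ t v) t"
  have "?s v = 0"
    using notin_tl_down_path[OF assms(1)] by (simp add: funpow_trickle[OF assms(1)] funpow_drop_grain_other)
  then have "(trickle G r T v ^^ n) ?s = ?s" for n
    by (induction n) (simp_all add: trickle_def)
  moreover have "landslide_topple G r T v t = (trickle G r T v ^^ (T v - t v)) ?s"
    using assms(2) by (simp add: landslide_topple_def flip: funpow_add[THEN fun_cong, unfolded o_def])
  ultimately show ?thesis
    by (simp add: funpow_trickle[OF assms(1)])
qed

lemma source_eq: "source G r T l t = drop_grain T (down_path G r l) t"
  by (simp add: source_def drop_grain_def)

lemma landslide_step_states:
  assumes g: "g \<in> verts G <+> verts G" and t: "t \<in> states G T"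
  shows "landslide_step G r T g t \<in> states G T"
proof (cases g)
  case (Inl v)
  with g have v: "v \<in> verts G" by auto
  have "set (tl (down_path G r v)) \<subseteq> verts G"
    using set_down_path_subset[OF v] by (subst (asm) down_path_eq_Cons[OF v]) simp
  moreover have "t(v := 0) \<in> states G T"
    using t v by (simp add: states_upd)
  ultimately show ?thesis
    using states_le[OF t v]
    by (simp add: Inl landslide_step_def landslide_topple_eq v funpow_drop_grain_states)
next
  case (Inr l)
  with g have "l \<in> verts G" by auto
  then show ?thesis
    using drop_grain_states[OF t set_down_path_subset]
    by (simp add: Inr landslide_step_def source_eq)
qed

lemma fold_landslide_step_states:
  "set w \<subseteq> verts G <+> verts G \<Longrightarrow> t \<in> states G T \<Longrightarrow> fold (landslide_step G r T) w t \<in> states G T"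
  by (induction w arbitrary: t) (auto intro!: landslide_step_states)

lemma landslide_step_emptied:
  assumes "v \<in> verts G" "t \<in> states G T"
  shows "landslide_step G r T (Inl v) t v = 0"
  using assms notin_tl_down_path[OF assms(1)]
  by (simp add: landslide_step_def landslide_topple_eq states_le funpow_drop_grain_other)

text \<open>Emptying a vertex \<open>u\<close> above \<open>v\<close> lowers the load by
  \<open>t u\<close>, and the same \<open>t u\<close> grains then enter the flow, so no net grain is
  added. Toppling \<open>v\<close> itself is excluded because it resets \<open>v\<close> to
  0.\<close>

lemma flow_landslide_step:
  assumes g: "g \<in> verts G <+> verts G" "g \<noteq> Inl v" and v: "v \<in> verts G" and t: "t \<in> states G T"
  shows "flow G r T v (grains G r g v) t (landslide_step G r T g t)"
proof (cases g)
  case (Inl u)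
  with g have u: "u \<in> verts G" "u \<noteq> v" by auto
  have path: "down_path G r u = [u] @ tl (down_path G r u)"
    using down_path_eq_Cons[OF u(1)] by simp
  have "t(u := 0) \<in> states G T"
    using t u by (simp add: states_upd)
  then have "flow G r T v (if v \<in> set (tl (down_path G r u)) then t u else 0)
      (t(u := 0)) (landslide_step G r T g t)"
    using flow_funpow_drop_grain[OF u(1) v path, where n = "t u"] u t
    by (simp add: Inl landslide_step_def landslide_topple_eq states_le)
  then show ?thesis
    using load_upd[of v t u 0] u
    by (auto simp: flow_def grains_def Inl strictly_above_def split: if_splits)
next
  case (Inr l)
  then have "l \<in> verts G"
    using g by auto
  then show ?thesis
    using flow_drop_grain[of l "[]" "down_path G r l" t v T] states_le[OF t v]
    by (simp add: Inr landslide_step_def source_eq grains_def)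
qed

lemma flow_fold_landslide_step:
  assumes "set w \<subseteq> verts G <+> verts G" "Inl v \<notin> set w" "v \<in> verts G" "t \<in> states G T"
  shows "flow G r T v (\<Sum>g\<leftarrow>w. grains G r g v) t (fold (landslide_step G r T) w t)"
  using assms
proof (induction w arbitrary: t)
  case Nil
  then show ?case by (simp add: flow_refl states_le)
next
  case (Cons g w)
  then have "flow G r T v (grains G r g v) t (landslide_step G r T g t)"
    by (intro flow_landslide_step) auto
  moreover have "flow G r T v (\<Sum>g\<leftarrow>w. grains G r g v) (landslide_step G r T g t)
      (fold (landslide_step G r T) w (landslide_step G r T g t))"
    using Cons.prems by (intro Cons.IH) (auto intro: landslide_step_states)
  ultimately show ?case
    using flow_trans by fastforce
qed

section \<open>Values depend only on the vertices above\<close>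

text \<open>By \<open>flow\<close>, the new value at \<open>v\<close> is a function of its old value
  and of the old and new loads above it; the new load is settled by induction from the
  leaves.\<close>

lemma landslide_step_local:
  assumes "g \<in> verts G <+> verts G" "v \<in> verts G" "t \<in> states G T" "t' \<in> states G T"
    and "\<And>u. u \<in> insert v (strictly_above G r v) \<Longrightarrow> t u = t' u"
  shows "landslide_step G r T g t v = landslide_step G r T g t' v"
  using assms(2,5)
proof (induction "card (strictly_above G r v)" arbitrary: v rule: less_induct)
  case less
  show ?case
  proof (cases "g = Inl v")
    case True
    then show ?thesis using landslide_step_emptied assms less.prems by simp
  next
    case False
    have "landslide_step G r T g t u = landslide_step G r T g t' u"
      if "u \<in> strictly_above G r v" for u
      using that less.prems card_strictly_above_less[OF that] strictly_above_mono[OF that]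
        strictly_above_subset by (intro less.hyps) auto
    then have "load G r v (landslide_step G r T g t) = load G r v (landslide_step G r T g t')"
      by (simp add: load_def)
    moreover have "load G r v t = load G r v t'"
      using less.prems by (simp add: load_def)
    ultimately show ?thesis
      using flow_landslide_step[OF assms(1) False less.prems(1)] assms(3,4) less.prems(2)
      by (simp add: flow_def)
  qed
qed

lemma fold_landslide_step_local:
  assumes "set w \<subseteq> verts G <+> verts G" "v \<in> verts G" "t \<in> states G T" "t' \<in> states G T"
    and "\<And>u. u \<in> insert v (strictly_above G r v) \<Longrightarrow> t u = t' u"
  shows "fold (landslide_step G r T) w t v = fold (landslide_step G r T) w t' v"
  using assms
proof (induction w arbitrary: t t')
  case (Cons g w)
  have "landslide_step G r T g t u = landslide_step G r T g t' u"
    if u: "u \<in> insert v (strictly_above G r v)" for u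
  proof -
    have "u \<in> verts G" "strictly_above G r u \<subseteq> insert v (strictly_above G r v)"
      using u Cons.prems(2) strictly_above_mono strictly_above_subset by blast+
    with u Cons.prems show ?thesis
      by (intro landslide_step_local) auto
  qed
  then have "fold (landslide_step G r T) w (landslide_step G r T g t) v =
      fold (landslide_step G r T) w (landslide_step G r T g t') v"
    using Cons.prems by (intro Cons.IH) (auto intro: landslide_step_states)
  then show ?case by simp
qed simp

text \<open>Until \<open>v\<close> is first toppled, agreement strictly above \<open>v\<close> is
  preserved. That topple empties \<open>v\<close> in both runs, and from then on locality applies at
  \<open>v\<close> as well.\<close>

lemma fold_landslide_step_forgets:
  assumes "set w \<subseteq> verts G <+> verts G" "Inl v \<in> set w" "v \<in> verts G"
    and "t \<in> states G T" "t' \<in> states G T"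
    and "\<And>u. u \<in> strictly_above G r v \<Longrightarrow> t u = t' u"
  shows "fold (landslide_step G r T) w t v = fold (landslide_step G r T) w t' v"
  using assms
proof (induction w arbitrary: t t')
  case (Cons g w)
  have above: "landslide_step G r T g t u = landslide_step G r T g t' u"
    if u: "u \<in> strictly_above G r v" for u
  proof -
    have "u \<in> verts G" "strictly_above G r u \<subseteq> strictly_above G r v"
      using u strictly_above_mono strictly_above_subset by blast+
    with u Cons.prems show ?thesis
      by (intro landslide_step_local) auto
  qed
  have states: "landslide_step G r T g t \<in> states G T" "landslide_step G r T g t' \<in> states G T"
    using Cons.prems by (auto intro: landslide_step_states)
  show ?case
  proof (cases "g = Inl v")
    case True
    then have "landslide_step G r T g t v = landslide_step G r T g t' v"
      using Cons.prems by (simp add: landslide_step_emptied)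
    then have "fold (landslide_step G r T) w (landslide_step G r T g t) v =
        fold (landslide_step G r T) w (landslide_step G r T g t') v"
      using above states Cons.prems by (intro fold_landslide_step_local) auto
    then show ?thesis by simp
  next
    case False
    then have "set w \<subseteq> verts G <+> verts G" "Inl v \<in> set w"
      using Cons.prems by auto
    from Cons.IH[OF this Cons.prems(3) states above] show ?thesis
      by simp
  qed
qed simp

section \<open>Counting fixed points\<close>

text \<open>If \<open>v\<close> is toppled, the final value is independent of \<open>a\<close>, so
  one \<open>a\<close> is fixed. Otherwise \<open>a\<close> becomes \<open>min (T v) (a + k)\<close>
  for the number \<open>k\<close> of source grains, which fixes every \<open>a\<close> if
  \<open>k = 0\<close> and only \<open>T v\<close> if \<open>k > 0\<close>.\<close>

lemma card_fixed_extensions: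
  assumes w: "set w \<subseteq> verts G <+> verts G" and v: "v \<in> verts G" and t: "t \<in> states G T"
    and above: "\<And>u. u \<in> strictly_above G r v \<Longrightarrow> fold (landslide_step G r T) w t u = t u"
  shows "card {a. a \<le> T v \<and> fold (landslide_step G r T) w (t(v := a)) v = a} =
    (if v \<in> touched G r w then 1 else T v + 1)"
proof -
  let ?f = "fold (landslide_step G r T) w"
  have upd: "t(v := a) \<in> states G T" if "a \<le> T v" for a
    using t v that by (rule states_upd)
  show ?thesis
  proof (cases "Inl v \<in> set w")
    case True
    have "?f (t(v := a)) v = ?f t v" if "a \<le> T v" for a
      using fold_landslide_step_forgets[OF w True v upd[OF that] t] by fastforce
    moreover have "?f t v \<le> T v"
      using fold_landslide_step_states[OF w t] v by (rule states_le)
    ultimately have "{a. a \<le> T v \<and> ?f (t(v := a)) v = a} = {?f t v}"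
      by auto
    then show ?thesis using True by (simp add: touched_iff)
  next
    case False
    define k where "k = (\<Sum>g\<leftarrow>w. grains G r g v)"
    \<comment> \<open>Vertices strictly above \<open>v\<close> do not see the value
      \<open>a\<close>, so they stay fixed and the load is unchanged; hence exactly \<open>k\<close>
      grains are offered to \<open>v\<close>.\<close>
    have "?f (t(v := a)) v = min (T v) (a + k)" if a: "a \<le> T v" for a
    proof -
      have "?f (t(v := a)) u = (t(v := a)) u" if "u \<in> strictly_above G r v" for u
      proof -
        have "u \<noteq> v" "v \<notin> strictly_above G r u" "u \<in> verts G"
          using that strictly_above_mono[OF that] strictly_above_subset by auto
        then have "?f (t(v := a)) u = ?f t u"
          using fold_landslide_step_local[OF w _ upd[OF a] t, of u] by fastforce
        then show ?thesis using above[OF that] \<open>u \<noteq> v\<close> by simp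
      qed
      then have "load G r v (?f (t(v := a))) = load G r v (t(v := a))"
        by (simp add: load_def)
      then show ?thesis
        using flow_fold_landslide_step[OF w False v upd[OF a]] by (simp add: flow_def k_def)
    qed
    then have "{a. a \<le> T v \<and> ?f (t(v := a)) v = a} = (if k = 0 then {..T v} else {T v})"
      by (auto simp: min_def split: if_splits)
    then show ?thesis using False by (simp add: touched_iff k_def[symmetric])
  qed
qed

text \<open>
  The vertices outside \<open>A\<close> do not influence those in the upward closed set \<open>A\<close>; setting them to 0
  picks one representative for each partial state on \<open>A\<close>.
\<close>

lemma card_partial_fixed_points:
  assumes w: "set w \<subseteq> verts G <+> verts G" and "A \<subseteq> verts G"
    and "\<And>v. v \<in> A \<Longrightarrow> strictly_above G r v \<subseteq> A"
  shows "card {t \<in> states G T. (\<forall>v\<in>A. fold (landslide_step G r T) w t v = t v) \<and>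
      (\<forall>v\<in>verts G - A. t v = 0)} = (\<Prod>v\<in>A - touched G r w. T v + 1)"
proof -
  let ?f = "fold (landslide_step G r T) w"
  let ?F = "\<lambda>A. {t \<in> states G T. (\<forall>v\<in>A. ?f t v = t v) \<and> (\<forall>v\<in>verts G - A. t v = 0)}"
  have "finite A" using assms(2) by (rule finite_subset) simp
  then show ?thesis using assms(2,3)
  proof (induction A rule: finite_psubset_induct)
    case (psubset A)
    show ?case
    proof (cases "A = {}")
      case True
      have "?F {} = {\<lambda>v. if v \<in> verts G then 0 else undefined}"
        by (auto simp: states_def PiE_iff extensional_def fun_eq_iff)
      then show ?thesis using True by simp
    next
      case False
      \<comment> \<open>A vertex with the most vertices above it lies above no vertex of
        \<open>A\<close>, so removing it leaves an upward closed set.\<close>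
      define m where "m = Max ((\<lambda>v. card (strictly_above G r v)) ` A)"
      have "m \<in> (\<lambda>v. card (strictly_above G r v)) ` A"
        unfolding m_def using False psubset.hyps(1) by (intro Max_in) auto
      then obtain v where vA: "v \<in> A" and m: "card (strictly_above G r v) = m" by blast
      have max: "v \<notin> strictly_above G r u" if "u \<in> A" for u
      proof
        assume "v \<in> strictly_above G r u"
        then have "m < card (strictly_above G r u)"
          using card_strictly_above_less m by blast
        moreover have "card (strictly_above G r u) \<le> m"
          unfolding m_def using that psubset.hyps(1) by auto
        ultimately show False by simp
      qed
      have v: "v \<in> verts G" using vA psubset.prems by blast
      let ?B = "A - {v}"
      let ?N = "\<lambda>t. {a. a \<le> T v \<and> ?f (t(v := a)) v = a}"
      have unaffected: "?f (t(v := a)) u = ?f t u"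
        if "t \<in> states G T" "a \<le> T v" "u \<in> ?B" for t a u
        using that max[of u] psubset.prems v
        by (intro fold_landslide_step_local[OF w]) (auto intro: states_upd)
      have IH: "card (?F ?B) = (\<Prod>v\<in>?B - touched G r w. T v + 1)"
        using vA psubset.prems max by (intro psubset.IH) fastforce+
      have above: "strictly_above G r v \<subseteq> ?B"
        using psubset.prems(2)[OF vA] max[OF vA] by blast
      have N: "card (?N t) = (if v \<in> touched G r w then 1 else T v + 1)" if "t \<in> ?F ?B" for t
        using that above by (intro card_fixed_extensions[OF w v]) auto
      \<comment> \<open>A fixed state on \<open>A\<close> is a fixed state on \<open>?B\<close>
        together with a fixed value at \<open>v\<close>. Resetting \<open>v\<close> to 0 recovers
        the representative on \<open>?B\<close>.\<close>
      have "bij_betw (\<lambda>(t, a). t(v := a)) (Sigma (?F ?B) ?N) (?F A)"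
      proof (rule bij_betw_byWitness[where f' = "\<lambda>t. (t(v := 0), t v)"])
        show "\<forall>ta\<in>Sigma (?F ?B) ?N. (((\<lambda>(t, a). t(v := a)) ta)(v := 0), (\<lambda>(t, a). t(v := a)) ta v) = ta"
          using v by (auto simp: fun_upd_idem)
        show "\<forall>t\<in>?F A. (\<lambda>(t, a). t(v := a)) (t(v := 0), t v) = t"
          by simp
        show "(\<lambda>(t, a). t(v := a)) ` Sigma (?F ?B) ?N \<subseteq> ?F A"
          using v vA unaffected by (auto intro: states_upd)
        show "(\<lambda>t. (t(v := 0), t v)) ` ?F A \<subseteq> Sigma (?F ?B) ?N"
          using v vA unaffected[of _ 0] by (auto intro: states_upd simp: states_le split: if_splits)
            (metis DiffI neq0_conv)
      qed
      then have "card (?F A) = card (Sigma (?F ?B) ?N)"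
        by (rule bij_betw_same_card[symmetric])
      also have "\<dots> = (\<Sum>t\<in>?F ?B. card (?N t))"
      proof (rule card_SigmaI)
        have "finite (states G T)"
          by (simp add: states_def finite_PiE)
        then show "finite (?F ?B)" by simp
      qed simp
      also have "\<dots> = card (?F ?B) * (if v \<in> touched G r w then 1 else T v + 1)"
        by (simp add: N)
      also have "\<dots> = (\<Prod>v\<in>A - touched G r w. T v + 1)"
      proof (cases "v \<in> touched G r w")
        case True
        then have "?B - touched G r w = A - touched G r w" by auto
        then show ?thesis using True IH by simp
      next
        case False
        have "A - touched G r w - {v} = ?B - touched G r w" by auto
        then show ?thesis
          using False IH vA psubset.hyps(1)
          by (simp add: prod.remove[of "A - touched G r w" v] mult.commute)
      qed
      finally show ?thesis .
    qed
  qed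
qed

lemma card_fixed_points:
  assumes w: "set w \<subseteq> verts G <+> verts G"
  shows "card {t \<in> states G T. fold (landslide_step G r T) w t = t} =
    (\<Prod>v\<in>verts G - touched G r w. T v + 1)"
proof -
  have "(\<forall>v\<in>verts G. fold (landslide_step G r T) w t v = t v) \<longleftrightarrow>
      fold (landslide_step G r T) w t = t" if "t \<in> states G T" for t
    using fold_landslide_step_states[OF w that] that
    unfolding states_def by (auto intro: PiE_ext)
  then have "{t \<in> states G T. fold (landslide_step G r T) w t = t} = {t \<in> states G T.
      (\<forall>v\<in>verts G. fold (landslide_step G r T) w t v = t v) \<and> (\<forall>v\<in>verts G - verts G. t v = 0)}"
    by auto
  then show ?thesis
    using card_partial_fixed_points[OF w subset_refl strictly_above_subset] by simp
qed

end

text \<open>Expanding the product selects a subset of \<open>V - C\<close>, whose complement in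
  \<open>V\<close> is the superset \<open>S\<close> of \<open>C\<close>.\<close>

lemma prod_Suc_eq_sum_supersets:
  fixes T :: "'a \<Rightarrow> nat"
  assumes "finite V" "C \<subseteq> V"
  shows "(\<Prod>v\<in>V - C. T v + 1) = (\<Sum>S\<in>{S \<in> Pow V. C \<subseteq> S}. \<Prod>v\<in>V - S. T v)"
proof -
  have "(\<Prod>v\<in>V - C. T v + 1) = (\<Sum>R\<in>Pow (V - C). \<Prod>v\<in>R. T v)"
    using prod_add[of "V - C" T "\<lambda>_. 1"] assms by simp
  also have "\<dots> = (\<Sum>S\<in>{S \<in> Pow V. C \<subseteq> S}. \<Prod>v\<in>V - S. T v)"
    by (rule sum.reindex_bij_witness[of _ "\<lambda>S. V - S" "\<lambda>S. V - S"]) (use assms(2) in \<open>auto intro!: prod.cong\<close>)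
  finally show ?thesis .
qed

theorem theorem2p10:
  fixes G :: "('a, 'b) pre_digraph" and r :: 'a and T :: "'a \<Rightarrow> nat"
    and x y :: "'a \<Rightarrow> real" and ts :: "('a \<Rightarrow> nat) list"
  assumes "arborescence G r"
    and "\<And>v. v \<in> verts G \<Longrightarrow> 0 < T v"
    and "\<And>v. v \<in> verts G \<Longrightarrow> 0 < x v \<and> x v \<le> 1"
    and "\<And>l. l \<in> leaves G \<Longrightarrow> 0 < y l \<and> y l \<le> 1"
    and "(\<Sum>v\<in>verts G. x v) + (\<Sum>l\<in>leaves G. y l) = 1"
    and "distinct ts" and "set ts = states G T"
  shows "char_poly (landslide_matrix G r T x y ts) =
    (\<Prod>S\<in>Pow (verts G).
       [:- (leaf_weight G r y S + (\<Sum>v\<in>S. x v)), 1:] ^ (\<Prod>v\<in>verts G - S. T v))"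
proof -
  interpret arborescence G r by fact
  \<comment> \<open>Tagging topples by \<open>Inl\<close> and sources by \<open>Inr\<close> keeps
    operators apart even when they induce equal maps, so their probabilities add. The letters in
    \<open>?B S\<close> have total weight \<open>y_S + x_S\<close>.\<close>
  let ?A = "verts G <+> leaves G"
  let ?B = "\<lambda>S. S <+> {l \<in> leaves G. set (down_path G r l) \<subseteq> S}"
  let ?p = "case_sum x y"
  have leaves: "leaves G \<subseteq> verts G" by (auto simp: leaves_def)
  then have fin: "finite (leaves G)" by (rule finite_subset) simp
  have A: "?A \<subseteq> verts G <+> verts G" using leaves by auto
  have "(\<Sum>g\<in>{g \<in> ?A. landslide_step G r T g t = t'}. ?p g) = landslide_prob G r T x y t' t" for t t'
  proof -
    have "{g \<in> ?A. landslide_step G r T g t = t'} =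
        {v \<in> verts G. landslide_topple G r T v t = t'} <+> {l \<in> leaves G. source G r T l t = t'}"
      by (auto simp: landslide_step_def)
    then show ?thesis
      using fin by (simp add: landslide_prob_def sum.Plus)
  qed
  then have matrix: "landslide_matrix G r T x y ts = action_matrix ?A (landslide_step G r T) ?p ts"
    by (simp add: landslide_matrix_def action_matrix_def)
  have "char_poly (action_matrix ?A (landslide_step G r T) ?p ts) =
      (\<Prod>S\<in>Pow (verts G). [:- (\<Sum>g\<in>?B S. ?p g), 1:] ^ (\<Prod>v\<in>verts G - S. T v))"
  proof (rule char_poly_action_matrix)
    show "landslide_step G r T g t \<in> set ts" if "g \<in> ?A" "t \<in> set ts" for g t
      using that A assms(7) by (auto intro!: landslide_step_states)
    fix w assume w: "set w \<subseteq> ?A"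
    then have touched: "touched G r w \<subseteq> verts G"
      using leaves set_down_path_subset by (fastforce simp: touched_def)
    \<comment> \<open>This translates supersets of the touched set, which index the expanded fixed
      point count, into the alphabets \<open>?B S\<close> required for the characteristic
      polynomial.\<close>
    have allowed: "touched G r w \<subseteq> S \<longleftrightarrow> set w \<subseteq> ?B S" for S
    proof
      assume S: "touched G r w \<subseteq> S"
      show "set w \<subseteq> ?B S"
      proof
        fix g assume "g \<in> set w"
        with S w show "g \<in> ?B S"
          by (cases g) (auto simp: touched_def)
      qed
    next
      assume "set w \<subseteq> ?B S"
      then have "g \<in> ?B S" if "g \<in> set w" for g
        using that by blast
      from this[of "Inl _"] this[of "Inr _"] show "touched G r w \<subseteq> S"
        by (auto simp: touched_def)
    qed
    have "card {t \<in> set ts. fold (landslide_step G r T) w t = t} =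
        (\<Prod>v\<in>verts G - touched G r w. T v + 1)"
      unfolding assms(7) using w A by (intro card_fixed_points) blast
    also have "\<dots> = (\<Sum>S\<in>{S \<in> Pow (verts G). touched G r w \<subseteq> S}. \<Prod>v\<in>verts G - S. T v)"
      using touched by (intro prod_Suc_eq_sum_supersets) auto
    finally show "card {t \<in> set ts. fold (landslide_step G r T) w t = t} =
        (\<Sum>S\<in>{S \<in> Pow (verts G). set w \<subseteq> ?B S}. \<Prod>v\<in>verts G - S. T v)"
      unfolding allowed .
  qed (use fin assms(6) in auto)
  moreover have "(\<Sum>g\<in>?B S. ?p g) = leaf_weight G r y S + (\<Sum>v\<in>S. x v)" if "S \<subseteq> verts G" for S
    using that fin finite_subset[OF that] by (simp add: leaf_weight_def sum.Plus)
  ultimately show ?thesis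
    by (simp add: matrix)
qed

end
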